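(* Let $(\overline{T}_t)_{t\in\mathbb{R}_{\ge 0}}$ be a semigroup of sublinear transition operators on $\mathscr{B}$. If this semigroup is uniformly continuous, then $\ln\overline{T}_1:=\lim_{n\to+\infty}n(\overline{T}_{1/n}-I)$ is a bounded sublinear rate operator, and $$\overline{T}_t=e^{t\ln\overline{T}_1}\quad\text{for all } t\in\mathbb{R}_{\ge 0}.$$
   Context: Let $\mathcal{X}$ be a nonempty countable (finite or countably infinite) set and let $\mathscr{B}$ be the real vector space of bounded functions $\mathcal{X}\to\mathbb{R}$, with norm $\|f\|_\infty=\sup\{|f(x)|: x\in\mathcal{X}\}$. Inequalities between functions are pointwise and a real number is identified with the corresponding constant function. An operator is a (possibly nonlinear) map $\mathscr{B}\to\mathscr{B}$; $I$ is the identity operator; sums and real multiples of operators are defined pointwise, products and powers are compositions. For an operator $A$, $\|A\|_{\mathrm s}=\sup\{\|Af\|_\infty/\|f\|_\infty : f\in\mathscr{B}, f\ne 0\}$; $A$ is bounded if $\|A\|_{\mathrm s}<+\infty$. On the vector space of bounded operators one uses the norm $\|A\|_{\mathrm b}=\|A0\|_\infty+\|A\|_{\mathrm s}$, and limits of bounded operators are with respect to this norm. A sublinear transition operator is an operator $\overline{T}$ such that $\overline{T}(\lambda f)=\lambda\overline{T}f$ for all $f\in\mathscr{B}$ and real $\lambda\ge 0$; $\overline{T}(f+g)\le\overline{T}f+\overline{T}g$ for all $f,g\in\mathscr{B}$; and $\overline{T}f\le\sup f$ for all $f\in\mathscr{B}$. (Such operators are bounded.) A sublinear rate operator is an operator $\overline{Q}$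 such that $\overline{Q}(\lambda f)=\lambda\overline{Q}f$ for all $f\in\mathscr{B}$ and real $\lambda\ge 0$; $\overline{Q}(f+g)\le\overline{Q}f+\overline{Q}g$ for all $f,g\in\mathscr{B}$; $\overline{Q}\mu=0$ for all constants $\mu\in\mathbb{R}$; and $[\overline{Q}f](x)\le 0$ for all $f\in\mathscr{B}$ and $x\in\mathcal{X}$ with $\sup f=f(x)\ge 0$. For a bounded sublinear rate operator $\overline{Q}$ and $t\ge 0$, $e^{t\overline{Q}}:=\lim_{n\to+\infty}(I+\frac{t}{n}\overline{Q})^n$ (this limit with respect to $\|\cdot\|_{\mathrm b}$ exists). A semigroup is a family $(S_t)_{t\in\mathbb{R}_{\ge0}}$ of operators with $S_0=I$ and $S_{s+t}=S_sS_t$ for all $s,t\ge 0$. A semigroup of bounded operators is uniformly continuous if $\lim_{s\to t}\|S_s-S_t\|_{\mathrm b}=0$ for all $t\ge 0$. For a uniformly continuous semigroup of sublinear transition operators, the limit $\lim_{n\to+\infty}n(\overline{T}_{1/n}-I)$ with respect to $\|\cdot\|_{\mathrm b}$ exists. *)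

theory Defs
  imports "HOL-Analysis.Analysis"
begin

text \<open>
  On a discrete space every function is continuous, so \<open>'a \<Rightarrow>\<^sub>C real\<close> with
  \<open>'a :: {countable, discrete_topology}\<close> is the space of all bounded real functions on a nonempty
  countable set, and its library norm is the supremum norm; the first two lemmas confirm this.
\<close>

type_synonym 'a bfun = "'a \<Rightarrow>\<^sub>C real"

lemma bfun_iff_bounded:
  fixes f :: "'a::discrete_topology \<Rightarrow> real"
  shows "f \<in> range apply_bcontfun \<longleftrightarrow> bounded (range f)"
proof -
  have "open A" for A :: "'a set"
    by (rule open_discrete)
  then have "continuous_on UNIV f"
    by (simp add: continuous_on_open_vimage)
  then have "f \<in> bcontfun \<longleftrightarrow> bounded (range f)"
    by (simp add: bcontfun_def)
  moreover have "range apply_bcontfun = (bcontfun :: ('a \<Rightarrow> real) set)"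
    by (rule type_definition.Rep_range[OF type_definition_bcontfun])
  ultimately show ?thesis
    by simp
qed

lemma norm_bfun_eq_SUP: "norm (f :: 'a::topological_space bfun) = (SUP x. \<bar>apply_bcontfun f x\<bar>)"
  by (simp add: norm_bcontfun_def dist_bcontfun.rep_eq)

type_synonym 'a operator = "'a bfun \<Rightarrow> 'a bfun"

text \<open>
  The values are extended reals because the supremum may be infinite; for \<open>f \<noteq> 0\<close> the
  division is a division of real numbers by a nonzero number.
\<close>

definition op_norm_s :: "'a::topological_space operator \<Rightarrow> ereal" where
  "op_norm_s A = (SUP f\<in>{f. f \<noteq> 0}. ereal (norm (A f) / norm f))"

definition bounded_operator :: "'a::topological_space operator \<Rightarrow> bool" where
  "bounded_operator A \<longleftrightarrow> op_norm_s A < \<infinity>"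

definition op_norm_b :: "'a::topological_space operator \<Rightarrow> ereal" where
  "op_norm_b A = ereal (norm (A 0)) + op_norm_s A"

definition op_tendsto :: "(nat \<Rightarrow> 'a::topological_space operator) \<Rightarrow> 'a operator \<Rightarrow> bool" where
  "op_tendsto A L \<longleftrightarrow> (\<forall>n. bounded_operator (A n)) \<and> bounded_operator L \<and>
     (\<lambda>n. op_norm_b (\<lambda>f. A n f - L f)) \<longlonglongrightarrow> 0"

definition op_convergent :: "(nat \<Rightarrow> 'a::topological_space operator) \<Rightarrow> bool" where
  "op_convergent A \<longleftrightarrow> (\<exists>L. op_tendsto A L)"

definition op_lim :: "(nat \<Rightarrow> 'a::topological_space operator) \<Rightarrow> 'a operator" where
  "op_lim A = (THE L. op_tendsto A L)"

definition sublinear_transition_operator :: "'a::topological_space operator \<Rightarrow> bool" where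
  "sublinear_transition_operator T \<longleftrightarrow>
     (\<forall>f. \<forall>c\<ge>0. T (c *\<^sub>R f) = c *\<^sub>R T f) \<and>
     (\<forall>f g x. apply_bcontfun (T (f + g)) x \<le> apply_bcontfun (T f) x + apply_bcontfun (T g) x) \<and>
     (\<forall>f x. apply_bcontfun (T f) x \<le> (SUP y. apply_bcontfun f y))"

definition sublinear_rate_operator :: "'a::topological_space operator \<Rightarrow> bool" where
  "sublinear_rate_operator Q \<longleftrightarrow>
     (\<forall>f. \<forall>c\<ge>0. Q (c *\<^sub>R f) = c *\<^sub>R Q f) \<and>
     (\<forall>f g x. apply_bcontfun (Q (f + g)) x \<le> apply_bcontfun (Q f) x + apply_bcontfun (Q g) x) \<and>
     (\<forall>\<mu>. Q (const_bcontfun \<mu>) = 0) \<and>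
     (\<forall>f x. (SUP y. apply_bcontfun f y) = apply_bcontfun f x \<and> apply_bcontfun f x \<ge> 0
        \<longrightarrow> apply_bcontfun (Q f) x \<le> 0)"

text \<open>In both sequences the index 0 yields a harmless bounded operator (\<open>id\<close> and 0, respectively).\<close>

definition op_exp :: "real \<Rightarrow> 'a::topological_space operator \<Rightarrow> 'a operator" where
  "op_exp t Q = op_lim (\<lambda>n. (\<lambda>f. f + (t / real n) *\<^sub>R Q f) ^^ n)"

definition log_approx :: "(real \<Rightarrow> 'a::topological_space operator) \<Rightarrow> nat \<Rightarrow> 'a operator" where
  "log_approx T n = (\<lambda>f. real n *\<^sub>R (T (1 / real n) f - f))"

definition op_log :: "(real \<Rightarrow> 'a::topological_space operator) \<Rightarrow> 'a operator" where
  "op_log T = op_lim (log_approx T)"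

text \<open>A family indexed by the nonnegative reals; values at negative indices are irrelevant.\<close>

definition operator_semigroup :: "(real \<Rightarrow> 'a::topological_space operator) \<Rightarrow> bool" where
  "operator_semigroup S \<longleftrightarrow> S 0 = id \<and> (\<forall>s\<ge>0. \<forall>t\<ge>0. S (s + t) = S s \<circ> S t)"

definition uniformly_continuous_family :: "(real \<Rightarrow> 'a::topological_space operator) \<Rightarrow> bool" where
  "uniformly_continuous_family S \<longleftrightarrow>
     (\<forall>t\<ge>0. ((\<lambda>s. op_norm_b (\<lambda>f. S s f - S t f)) \<longlongrightarrow> 0) (at t within {0..}))"

lemma op_tendsto_unique:
  fixes L M :: "'a::topological_space operator"
  assumes "op_tendsto A L" "op_tendsto A M"
  shows "L = M"
proof
  have lim: "(\<lambda>n. A n f) \<longlonglongrightarrow> K f" if "op_tendsto A K" for K :: "'a operator" and f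
  proof -
    let ?N = "\<lambda>n. op_norm_b (\<lambda>f. A n f - K f)"
    have N: "?N \<longlonglongrightarrow> 0"
      using that by (simp add: op_tendsto_def)
    have s_nonneg: "0 \<le> op_norm_s B" for B :: "'a operator"
    proof -
      have "const_bcontfun 1 \<noteq> (0 :: 'a bfun)"
        by (metis const_bcontfun.rep_eq zero_bcontfun.rep_eq zero_neq_one)
      then show ?thesis
        unfolding op_norm_s_def by (intro SUP_upper2[of "const_bcontfun 1"]) auto
    qed
    have bound: "ereal (norm (A n f - K f)) \<le> ?N n * ereal (1 + norm f)" for n
    proof (cases "f = 0")
      case True
      have "ereal (norm (A n 0 - K 0)) + 0 \<le> ?N n"
        unfolding op_norm_b_def using s_nonneg by (intro add_left_mono)
      then show ?thesis
        using True by (simp flip: one_ereal_def zero_ereal_def)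
    next
      case False
      have "ereal (norm (A n f - K f) / norm f) \<le> op_norm_s (\<lambda>f. A n f - K f)"
        unfolding op_norm_s_def using False by (intro SUP_upper2[of f]) auto
      also have "0 + op_norm_s (\<lambda>f. A n f - K f) \<le> ?N n"
        unfolding op_norm_b_def by (intro add_right_mono) simp
      finally have *: "ereal (norm (A n f - K f) / norm f) \<le> ?N n"
        by simp
      have "ereal (norm (A n f - K f))
          = ereal (norm (A n f - K f) / norm f) * ereal (norm f)"
        using False by simp
      also have "\<dots> \<le> ereal (norm (A n f - K f) / norm f) * ereal (1 + norm f)"
        unfolding times_ereal.simps ereal_less_eq by (intro mult_left_mono) auto
      also have "\<dots> \<le> ?N n * ereal (1 + norm f)"
        using * by (intro ereal_mult_right_mono) auto
      finally show ?thesis .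
    qed
    have "(\<lambda>n. ?N n * ereal (1 + norm f)) \<longlonglongrightarrow> 0 * ereal (1 + norm f)"
      using N by (intro tendsto_mult_ereal tendsto_const) auto
    then have upper: "(\<lambda>n. ?N n * ereal (1 + norm f)) \<longlonglongrightarrow> 0"
      by simp
    have "(\<lambda>n. ereal (norm (A n f - K f))) \<longlonglongrightarrow> 0"
      by (rule tendsto_sandwich[OF _ _ tendsto_const upper]) (use bound in auto)
    then have "(\<lambda>n. norm (A n f - K f)) \<longlonglongrightarrow> 0"
      by (simp add: zero_ereal_def)
    then show ?thesis
      using Lim_null tendsto_norm_zero_iff by blast
  qed
  show "L f = M f" for f
    using lim[OF assms(1)] lim[OF assms(2)] by (rule LIMSEQ_unique)
qed

lemma op_lim_eqI: "op_tendsto A L \<Longrightarrow> op_lim A = L"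
  unfolding op_lim_def using op_tendsto_unique by blast

end

theory Submission
  imports Defs
begin

text \<open>
  For a sublinear operator the bound \<open>\<parallel>A\<parallel>\<^sub>s\<close> is also a Lipschitz constant, and this applies to
  \<open>T\<^sub>s - I\<close>. Telescoping \<open>T\<^sub>n\<^sub>s - I\<close> into increments \<open>(T\<^sub>s - I) T\<^sub>k\<^sub>s\<close> and comparing each with
  \<open>T\<^sub>s - I\<close> gives \<open>\<parallel>T\<^sub>n\<^sub>s - I - n (T\<^sub>s - I)\<parallel> \<le> n \<parallel>T\<^sub>s - I\<parallel> max\<^sub>k \<parallel>T\<^sub>k\<^sub>s - I\<parallel>\<close>. Uniform continuity
  at 0 turns this first into \<open>\<parallel>T\<^sub>s - I\<parallel> \<le> C s\<close> and then into
  \<open>\<parallel>(T\<^sub>n\<^sub>s - I) / (n s) - (T\<^sub>s - I) / s\<parallel> \<le> C\<^sup>2 n s\<close>. Comparing the steps \<open>1/m\<close> and \<open>1/n\<close> with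
  \<open>1/(m n)\<close> shows that the difference quotients form a Cauchy sequence; its limit \<open>Q\<close> satisfies
  \<open>\<parallel>T\<^sub>s - I - s Q\<parallel> \<le> C\<^sup>2 s\<^sup>2\<close>, so the Euler scheme for \<open>Q\<close> converges to the semigroup.
\<close>

section \<open>Semigroups whose increments are Lipschitz\<close>

text \<open>Linearity is replaced by \<open>nonexpansive\<close> and by
  \<open>increment_lipschitz\<close>, which turns a norm bound on \<open>T s - I\<close> into a
  Lipschitz bound.\<close>

locale lipschitz_semigroup =
  fixes T :: "real \<Rightarrow> 'b::real_normed_vector \<Rightarrow> 'b" and \<delta> :: real
  assumes complete: "Cauchy (X :: nat \<Rightarrow> 'b) \<Longrightarrow> convergent X"
    and semigroup_zero: "T 0 f = f"
    and semigroup_add: "s \<ge> 0 \<Longrightarrow> t \<ge> 0 \<Longrightarrow> T (s + t) f = T s (T t f)"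
    and fixes_zero: "s \<ge> 0 \<Longrightarrow> T s 0 = 0"
    and nonexpansive: "s \<ge> 0 \<Longrightarrow> norm (T s f - T s g) \<le> norm (f - g)"
    and increment_lipschitz: "s \<ge> 0 \<Longrightarrow> (\<And>h. norm (T s h - h) \<le> e * norm h)
      \<Longrightarrow> norm ((T s f - f) - (T s g - g)) \<le> e * norm (f - g)"
    and \<delta>_pos: "\<delta> > 0"
    and near_id: "0 \<le> s \<Longrightarrow> s \<le> \<delta> \<Longrightarrow> norm (T s f - f) \<le> 1/2 * norm f"
begin

text \<open>\<open>e\<close> and \<open>d\<close> are kept apart because two choices occur:
  \<open>d = 1/2\<close> on the way to the linear bound on increments, then \<open>e = C * s\<close>
  and \<open>d = C * (n * s)\<close> for a quadratic remainder.\<close>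

lemma increment_multiple:
  assumes s: "s \<ge> 0" and e: "\<And>h. norm (T s h - h) \<le> e * norm h" and e0: "e \<ge> 0"
    and d: "\<And>k. k < n \<Longrightarrow> norm (T (real k * s) f - f) \<le> d * norm f"
  shows "norm (T (real n * s) f - f - real n *\<^sub>R (T s f - f)) \<le> real n * e * d * norm f"
  using d
proof (induction n)
  case 0
  then show ?case by (simp add: semigroup_zero)
next
  case (Suc n)
  let ?g = "T (real n * s) f"
  have "T (real (Suc n) * s) f = T s ?g"
    using semigroup_add[of s "real n * s" f] s by (simp add: algebra_simps)
  then have "T (real (Suc n) * s) f - f - real (Suc n) *\<^sub>R (T s f - f)
      = (?g - f - real n *\<^sub>R (T s f - f)) + ((T s ?g - ?g) - (T s f - f))"
    by (simp add: algebra_simps)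
  then have "norm (T (real (Suc n) * s) f - f - real (Suc n) *\<^sub>R (T s f - f))
      \<le> norm (?g - f - real n *\<^sub>R (T s f - f)) + norm ((T s ?g - ?g) - (T s f - f))"
    by (simp only: norm_triangle_ineq)
  also have "\<dots> \<le> real n * e * d * norm f + e * norm (?g - f)"
    using Suc increment_lipschitz[OF s e] by (intro add_mono) auto
  also have "\<dots> \<le> real n * e * d * norm f + e * (d * norm f)"
    using Suc.prems[of n] e0 by (intro add_left_mono mult_left_mono) auto
  finally show ?case
    by (simp add: algebra_simps)
qed

text \<open>
  The bound of \<open>increment_multiple\<close> with \<open>d = 1/2\<close> improves a Lipschitz constant \<open>1/n + r\<close> of the
  increment to \<open>1/n + r/2\<close>.
\<close>

lemma increment_le_inverse:
  assumes s: "s \<ge> 0" and n: "n > 0" "real n * s \<le> \<delta>"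
  shows "norm (T s f - f) \<le> 1 / real n * norm f"
proof -
  have small: "norm (T (real k * s) f - f) \<le> 1/2 * norm f" if "k \<le> n" for k f
  proof -
    have "real k * s \<le> real n * s"
      using that s by (intro mult_right_mono) auto
    then show ?thesis
      using s n by (intro near_id) auto
  qed
  \<comment> \<open>The bound is needed for all \<open>f\<close> at once, since the next round uses
    it as a Lipschitz constant.\<close>
  have step: "norm (T s f - f) \<le> (1 / real n + (1/2) ^ k) * norm f" for k f
  proof (induction k arbitrary: f)
    case 0
    have "norm (T s f - f) \<le> 1/2 * norm f"
      using small[of 1 f] n by simp
    also have "\<dots> \<le> (1 / real n + (1/2) ^ 0) * norm f"
      by (intro mult_right_mono) (auto intro: add_increasing)
    finally show ?case .
  next
    case (Suc k)
    let ?e = "1 / real n + (1/2) ^ k"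
    let ?D = "T s f - f"
    let ?E = "T (real n * s) f - f"
    have "norm (?E - real n *\<^sub>R ?D) \<le> real n * ?e * (1/2) * norm f"
      using s Suc small by (intro increment_multiple) auto
    moreover have "norm ?E \<le> 1/2 * norm f"
      by (rule small) simp
    moreover have "norm (real n *\<^sub>R ?D) \<le> norm ?E + norm (?E - real n *\<^sub>R ?D)"
      by (metis norm_triangle_sub norm_minus_commute)
    ultimately have "real n * norm ?D \<le> 1/2 * norm f + real n * ?e * (1/2) * norm f"
      by (simp del: times_divide_eq_left times_divide_eq_right)
    also have "\<dots> = real n * ((1 / real n + (1/2) ^ Suc k) * norm f)"
      using n by (simp add: field_simps)
    finally show ?case
      using n by (subst (asm) mult_le_cancel_left_pos) auto
  qed
  have "(\<lambda>k. (1 / real n + (1/2) ^ k) * norm f) \<longlonglongrightarrow> (1 / real n + 0) * norm f"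
    by (intro tendsto_intros LIMSEQ_power_zero) auto
  then show ?thesis
    using step by (intro LIMSEQ_le_const[where a = "norm (T s f - f)"]) auto
qed

text \<open>The factor 2 covers both the crude bound \<open>2 * norm f\<close> for
  \<open>s > \<delta>\<close> and the loss from rounding \<open>\<delta> / s\<close> down to an
  integer.\<close>

definition C :: real where "C = 2 / \<delta>"

lemma C_pos: "C > 0"
  using \<delta>_pos by (simp add: C_def)

lemma increment_le:
  assumes s: "s \<ge> 0"
  shows "norm (T s f - f) \<le> C * s * norm f"
proof -
  consider "s = 0" | "s > \<delta>" | "0 < s" "s \<le> \<delta>"
    using s by linarith
  then show ?thesis
  proof cases
    case 1
    then show ?thesis by (simp add: semigroup_zero)
  next
    case 2
    have "norm (T s f) \<le> norm f"
      using nonexpansive[OF s, of f 0] fixes_zero[OF s] by simp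
    then have "norm (T s f - f) \<le> 2 * norm f"
      using norm_triangle_ineq4[of "T s f" f] by simp
    also have "2 \<le> C * s"
      using 2 \<delta>_pos by (simp add: C_def field_simps)
    then have "2 * norm f \<le> C * s * norm f"
      by (intro mult_right_mono) auto
    finally show ?thesis .
  next
    case 3
    \<comment> \<open>The largest \<open>n\<close> with \<open>n * s \<le> \<delta>\<close>. Since
      \<open>\<delta> / s \<ge> 1\<close>, rounding down loses at most a factor 2.\<close>
    define n where "n = nat \<lfloor>\<delta> / s\<rfloor>"
    have ge1: "\<delta> / s \<ge> 1"
      using 3 by simp
    then have n1: "n \<ge> 1" and n_le: "real n \<le> \<delta> / s" and n_gt: "\<delta> / s < real n + 1"
      unfolding n_def by linarith+
    have "norm (T s f - f) \<le> 1 / real n * norm f"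
      using 3 n1 n_le by (intro increment_le_inverse) (auto simp: field_simps)
    also have "\<delta> \<le> 2 * s * real n"
    proof -
      have "\<delta> / s \<le> 2 * real n"
        using n_gt n1 by linarith
      then show ?thesis
        using 3 by (simp add: field_simps)
    qed
    then have "1 / real n \<le> C * s"
      using n1 \<delta>_pos by (simp add: C_def field_simps)
    then have "1 / real n * norm f \<le> C * s * norm f"
      by (intro mult_right_mono) auto
    finally show ?thesis .
  qed
qed

lemma increment_multiple_le:
  assumes s: "s \<ge> 0"
  shows "norm (T (real n * s) f - f - real n *\<^sub>R (T s f - f)) \<le> C\<^sup>2 * (real n * s)\<^sup>2 * norm f"
proof -
  have "norm (T (real k * s) f - f) \<le> C * (real n * s) * norm f" if "k < n" for k
  proof -
    have "C * (real k * s) * norm f \<le> C * (real n * s) * norm f"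
      using that s C_pos by (intro mult_right_mono mult_left_mono) auto
    then show ?thesis
      using increment_le[of "real k * s" f] s by simp
  qed
  then have "norm (T (real n * s) f - f - real n *\<^sub>R (T s f - f))
      \<le> real n * (C * s) * (C * (real n * s)) * norm f"
    using s C_pos increment_le[OF s] by (intro increment_multiple) auto
  then show ?thesis
    by (simp add: power2_eq_square algebra_simps)
qed

section \<open>Difference quotients and the generator\<close>

definition quot :: "nat \<Rightarrow> 'b \<Rightarrow> 'b" where
  "quot n f = real n *\<^sub>R (T (1 / real n) f - f)"

text \<open>Since \<open>n\<close> steps of length \<open>1 / (m * n)\<close> make up
  \<open>1 / m\<close>, the quadratic remainder depends on \<open>m\<close> alone; multiplying it by
  \<open>m\<close> leaves the rate \<open>1 / m\<close>.\<close>

lemma quot_refine: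
  assumes "m > 0" "n > 0"
  shows "norm (quot m f - quot (m * n) f) \<le> C\<^sup>2 / real m * norm f"
proof -
  let ?s = "1 / real (m * n)"
  have eq: "real n * ?s = 1 / real m"
    using assms by simp
  have "norm (T (real n * ?s) f - f - real n *\<^sub>R (T ?s f - f)) \<le> C\<^sup>2 * (real n * ?s)\<^sup>2 * norm f"
    by (rule increment_multiple_le) simp
  then have "norm (T (1 / real m) f - f - real n *\<^sub>R (T ?s f - f)) \<le> C\<^sup>2 * (1 / real m)\<^sup>2 * norm f"
    unfolding eq .
  then have "real m * norm (T (1 / real m) f - f - real n *\<^sub>R (T ?s f - f))
      \<le> real m * (C\<^sup>2 * (1 / real m)\<^sup>2 * norm f)"
    by (rule mult_left_mono) simp
  also have "real m * (C\<^sup>2 * (1 / real m)\<^sup>2 * norm f) = C\<^sup>2 / real m * norm f"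
    using assms by (simp add: power2_eq_square)
  also have "real m * norm (T (1 / real m) f - f - real n *\<^sub>R (T ?s f - f))
      = norm (real m *\<^sub>R (T (1 / real m) f - f - real n *\<^sub>R (T ?s f - f)))"
    by simp
  also have "real m *\<^sub>R (T (1 / real m) f - f - real n *\<^sub>R (T ?s f - f)) = quot m f - quot (m * n) f"
    by (simp only: quot_def scaleR_diff_right[of "real m" "T (1 / real m) f - f"] scaleR_scaleR of_nat_mult)
  finally show ?thesis .
qed

text \<open>Both quotients are compared with their common refinement at
  \<open>m * n\<close>.\<close>

lemma quot_dist:
  assumes "m > 0" "n > 0"
  shows "norm (quot m f - quot n f) \<le> (C\<^sup>2 / real m + C\<^sup>2 / real n) * norm f"
proof -
  have "norm (quot m f - quot n f)
      \<le> norm (quot m f - quot (m * n) f) + norm (quot n f - quot (n * m) f)"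
    using norm_triangle_ineq4[of "quot m f - quot (m * n) f" "quot n f - quot (n * m) f"]
    by (simp add: mult.commute)
  also have "\<dots> \<le> C\<^sup>2 / real m * norm f + C\<^sup>2 / real n * norm f"
    using assms by (intro add_mono quot_refine)
  finally show ?thesis
    by (simp add: algebra_simps)
qed

text \<open>The limit is taken pointwise; \<open>quot_generator\<close> later supplies an error
  proportional to \<open>norm f\<close>, as convergence in operator norm requires.\<close>

definition generator :: "'b \<Rightarrow> 'b" where
  "generator f = lim (\<lambda>n. quot n f)"

lemma quot_tendsto: "(\<lambda>n. quot n f) \<longlonglongrightarrow> generator f"
proof -
  have "Cauchy (\<lambda>n. quot n f)"
  proof (rule CauchyI)
    fix e :: real assume e: "e > 0"
    have "(\<lambda>n. C\<^sup>2 / real n * norm f) \<longlonglongrightarrow> 0 * norm f"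
      by (intro tendsto_intros lim_const_over_n)
    then have "eventually (\<lambda>n. C\<^sup>2 / real n * norm f < e / 2) sequentially"
      using e by (intro order_tendstoD) auto
    then obtain N where N: "\<And>n. n \<ge> N \<Longrightarrow> C\<^sup>2 / real n * norm f < e / 2"
      by (auto simp: eventually_sequentially)
    \<comment> \<open>\<open>Suc N\<close> keeps both indices positive, as \<open>quot_dist\<close>
      demands.\<close>
    have "norm (quot m f - quot n f) < e" if "m \<ge> Suc N" "n \<ge> Suc N" for m n
      using quot_dist[of m n f] N[of m] N[of n] that unfolding distrib_right by linarith
    then show "\<exists>M. \<forall>m\<ge>M. \<forall>n\<ge>M. norm (quot m f - quot n f) < e"
      by blast
  qed
  then show ?thesis
    unfolding generator_def using complete convergent_LIMSEQ_iff by blast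
qed

lemma quot_generator:
  assumes m: "m > 0"
  shows "norm (quot m f - generator f) \<le> C\<^sup>2 / real m * norm f"
proof (rule LIMSEQ_le)
  show "(\<lambda>n. norm (quot m f - quot n f)) \<longlonglongrightarrow> norm (quot m f - generator f)"
    by (intro tendsto_intros quot_tendsto)
  have "(\<lambda>n. (C\<^sup>2 / real m + C\<^sup>2 / real n) * norm f) \<longlonglongrightarrow> (C\<^sup>2 / real m + 0) * norm f"
    by (intro tendsto_intros lim_const_over_n)
  then show "(\<lambda>n. (C\<^sup>2 / real m + C\<^sup>2 / real n) * norm f) \<longlonglongrightarrow> C\<^sup>2 / real m * norm f"
    by simp
  show "\<exists>N. \<forall>n\<ge>N. norm (quot m f - quot n f) \<le> (C\<^sup>2 / real m + C\<^sup>2 / real n) * norm f"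
    using quot_dist[OF m] by (intro exI[of _ 1]) auto
qed

lemma quot_le: "norm (quot n f) \<le> C * norm f"
proof (cases "n = 0")
  case False
  then show ?thesis
    using mult_left_mono[OF increment_le[of "1 / real n" f], of "real n"] by (simp add: quot_def)
qed (use C_pos in \<open>simp add: quot_def\<close>)

lemma generator_le: "norm (generator f) \<le> C * norm f"
  using quot_le by (intro LIMSEQ_le_const2[OF tendsto_norm[OF quot_tendsto]]) auto

text \<open>With \<open>r n \<le> s\<close>, the semigroup law splits off \<open>T (r n)\<close>,
  and nonexpansiveness leaves only the increment over the short time \<open>s - r n\<close>.\<close>

lemma orbit_tendsto:
  assumes r: "r \<longlonglongrightarrow> s" "\<And>n. 0 \<le> r n" "\<And>n. r n \<le> s"
  shows "(\<lambda>n. T (r n) f) \<longlonglongrightarrow> T s f"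
proof -
  have "norm (T (r n) f - T s f) \<le> C * (s - r n) * norm f" for n
  proof -
    have "T s f = T (r n) (T (s - r n) f)"
      using semigroup_add[of "r n" "s - r n" f] r by simp
    then have "norm (T (r n) f - T s f) \<le> norm (f - T (s - r n) f)"
      using nonexpansive[of "r n" f "T (s - r n) f"] r by simp
    also have "\<dots> \<le> C * (s - r n) * norm f"
      using increment_le[of "s - r n" f] r by (simp add: norm_minus_commute)
    finally show ?thesis .
  qed
  moreover have "(\<lambda>n. C * (s - r n) * norm f) \<longlonglongrightarrow> C * (s - s) * norm f"
    by (intro tendsto_intros r)
  then have "(\<lambda>n. C * (s - r n) * norm f) \<longlonglongrightarrow> 0"
    by simp
  ultimately show ?thesis
    by (rule LIM_zero_cancel[OF Lim_null_comparison[OF always_eventually[OF allI]]])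
qed

text \<open>For multiples of \<open>1 / n\<close> this is \<open>increment_multiple_le\<close> with
  \<open>quot n\<close> in place of \<open>generator\<close>. A real \<open>s\<close> is
  approximated from below by such multiples, and both sides pass to the limit.\<close>

lemma increment_generator:
  assumes s: "s \<ge> 0"
  shows "norm (T s f - f - s *\<^sub>R generator f) \<le> C\<^sup>2 * s\<^sup>2 * norm f"
proof -
  define r where "r n = real (nat \<lfloor>s * real n\<rfloor>) / real n" for n
  have r0: "r n \<ge> 0" for n
    by (simp add: r_def)
  have r_le: "r n \<le> s" for n
  proof (cases "n = 0")
    case False
    have "real (nat \<lfloor>s * real n\<rfloor>) \<le> s * real n"
      using s by simp
    then show ?thesis
      using False by (simp add: r_def field_simps)
  qed (use s in \<open>simp add: r_def\<close>)
  have r_ge: "s - 1 / real n \<le> r n" if "n > 0" for n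
  proof -
    have "s * real n - 1 \<le> real (nat \<lfloor>s * real n\<rfloor>)"
      using s by linarith
    then have "(s * real n - 1) / real n \<le> r n"
      unfolding r_def by (rule divide_right_mono) simp
    then show ?thesis
      using that by (simp add: diff_divide_distrib)
  qed
  have r_lim: "r \<longlonglongrightarrow> s"
  proof (rule tendsto_sandwich)
    show "eventually (\<lambda>n. s - 1 / real n \<le> r n) sequentially"
      using r_ge eventually_gt_at_top[of 0] by (rule eventually_mono[rotated])
    have "(\<lambda>n. s - 1 / real n) \<longlonglongrightarrow> s - 0"
      by (intro tendsto_intros lim_const_over_n)
    then show "(\<lambda>n. s - 1 / real n) \<longlonglongrightarrow> s"
      by simp
  qed (use r_le in auto)
  have bound: "norm (T (r n) f - f - r n *\<^sub>R quot n f) \<le> C\<^sup>2 * (r n)\<^sup>2 * norm f" if "n > 0" for n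
    using increment_multiple_le[of "1 / real n" "nat \<lfloor>s * real n\<rfloor>" f] that
    by (simp add: r_def quot_def)
  show ?thesis
  proof (rule LIMSEQ_le)
    show "(\<lambda>n. norm (T (r n) f - f - r n *\<^sub>R quot n f)) \<longlonglongrightarrow> norm (T s f - f - s *\<^sub>R generator f)"
      by (intro tendsto_intros quot_tendsto orbit_tendsto r_lim r0 r_le)
    show "(\<lambda>n. C\<^sup>2 * (r n)\<^sup>2 * norm f) \<longlonglongrightarrow> C\<^sup>2 * s\<^sup>2 * norm f"
      by (intro tendsto_intros r_lim)
  qed (use bound in \<open>auto intro!: exI[of _ 1]\<close>)
qed

section \<open>Convergence of the Euler scheme\<close>

lemma semigroup_power:
  assumes "s \<ge> 0"
  shows "T (real n * s) f = (T s ^^ n) f"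
proof (induction n)
  case (Suc n)
  then show ?case
    using semigroup_add[of s "real n * s" f] assms by (simp add: algebra_simps)
qed (simp add: semigroup_zero)

lemma euler_step_le:
  assumes s: "s \<ge> 0"
  shows "norm (((\<lambda>f. f + s *\<^sub>R generator f) ^^ n) f) \<le> (1 + C * s) ^ n * norm f"
proof (induction n)
  case (Suc n)
  let ?g = "((\<lambda>f. f + s *\<^sub>R generator f) ^^ n) f"
  have "norm (?g + s *\<^sub>R generator ?g) \<le> norm ?g + s * norm (generator ?g)"
    using norm_triangle_ineq[of ?g "s *\<^sub>R generator ?g"] s by simp
  also have "\<dots> \<le> norm ?g + s * (C * norm ?g)"
    using s generator_le by (intro add_left_mono mult_left_mono)
  also have "\<dots> = (1 + C * s) * norm ?g"
    by (simp add: algebra_simps)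
  also have "\<dots> \<le> (1 + C * s) * ((1 + C * s) ^ n * norm f)"
    using Suc s C_pos by (intro mult_left_mono) auto
  finally show ?case
    by (simp add: mult.assoc)
qed simp

text \<open>Each step adds one local error of order \<open>s\<^sup>2\<close>, evaluated at an Euler
  iterate whose size \<open>euler_step_le\<close> controls.\<close>

lemma euler_error:
  assumes s: "s \<ge> 0"
  shows "norm ((T s ^^ n) f - ((\<lambda>f. f + s *\<^sub>R generator f) ^^ n) f)
    \<le> real n * (C\<^sup>2 * s\<^sup>2 * (1 + C * s) ^ n * norm f)"
proof (induction n)
  case (Suc n)
  let ?u = "(T s ^^ n) f"
  let ?g = "((\<lambda>f. f + s *\<^sub>R generator f) ^^ n) f"
  let ?b = "\<lambda>k. C\<^sup>2 * s\<^sup>2 * (1 + C * s) ^ k * norm f"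
  have mono: "?b n \<le> ?b (Suc n)"
    using s C_pos by (intro mult_right_mono mult_left_mono power_increasing) auto
  \<comment> \<open>The intermediate point \<open>T s ?g\<close> is an exact step from the Euler
    iterate, so the earlier error is carried on by the nonexpansive \<open>T s\<close> and does not
    grow.\<close>
  have "norm (T s ?u - (?g + s *\<^sub>R generator ?g))
      \<le> norm (T s ?u - T s ?g) + norm (T s ?g - ?g - s *\<^sub>R generator ?g)"
    using norm_triangle_ineq[of "T s ?u - T s ?g" "T s ?g - ?g - s *\<^sub>R generator ?g"]
    by (simp add: algebra_simps)
  also have "\<dots> \<le> norm (?u - ?g) + C\<^sup>2 * s\<^sup>2 * norm ?g"
    using s by (intro add_mono nonexpansive increment_generator)
  also have "\<dots> \<le> real n * ?b n + C\<^sup>2 * s\<^sup>2 * ((1 + C * s) ^ n * norm f)"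
    using Suc s by (intro add_mono mult_left_mono euler_step_le) auto
  also have "\<dots> = real n * ?b n + ?b n"
    by simp
  also have "\<dots> \<le> real n * ?b (Suc n) + ?b (Suc n)"
    using mono by (intro add_mono mult_left_mono) auto
  finally show ?case
    by (simp add: algebra_simps)
qed simp

text \<open>With \<open>s = t / n\<close>, the \<open>n\<close> local errors of order
  \<open>1 / n\<^sup>2\<close> sum to order \<open>1 / n\<close>, and the growth factor stays below
  \<open>exp (C * t)\<close>.\<close>

lemma euler_scheme_error:
  assumes t: "t \<ge> 0" and n: "n > 0"
  shows "norm (((\<lambda>f. f + (t / real n) *\<^sub>R generator f) ^^ n) f - T t f)
    \<le> C\<^sup>2 * t\<^sup>2 * exp (C * t) / real n * norm f"
proof -
  let ?s = "t / real n"
  have "(1 + C * ?s) ^ n \<le> exp (C * ?s) ^ n"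
    using t C_pos by (intro power_mono) auto
  also have "\<dots> = exp (C * t)"
    using n by (simp flip: exp_of_nat_mult)
  finally have pow: "(1 + C * ?s) ^ n \<le> exp (C * t)" .
  have "norm (((\<lambda>f. f + ?s *\<^sub>R generator f) ^^ n) f - T t f)
      = norm ((T ?s ^^ n) f - ((\<lambda>f. f + ?s *\<^sub>R generator f) ^^ n) f)"
    using semigroup_power[of ?s n f] t n by (simp add: norm_minus_commute)
  also have "\<dots> \<le> real n * (C\<^sup>2 * ?s\<^sup>2 * (1 + C * ?s) ^ n * norm f)"
    using t by (intro euler_error) auto
  also have "\<dots> \<le> real n * (C\<^sup>2 * ?s\<^sup>2 * exp (C * t) * norm f)"
    using pow by (intro mult_left_mono mult_right_mono) auto
  also have "\<dots> = C\<^sup>2 * t\<^sup>2 * exp (C * t) / real n * norm f"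
    using n by (simp add: power2_eq_square field_simps)
  finally show ?thesis .
qed

end

section \<open>Operator norms and sublinear operators\<close>

lemma op_norm_s_le:
  fixes A :: "'a::topological_space operator"
  assumes "\<And>f. norm (A f) \<le> c * norm f"
  shows "op_norm_s A \<le> ereal c"
  unfolding op_norm_s_def using assms by (intro SUP_least) (auto simp: field_simps)

lemma op_norm_s_nonneg: "0 \<le> op_norm_s (A :: 'a::topological_space operator)"
proof -
  have "const_bcontfun 1 \<noteq> (0 :: 'a bfun)"
    by (metis const_bcontfun.rep_eq zero_bcontfun.rep_eq zero_neq_one)
  then show ?thesis
    unfolding op_norm_s_def by (intro SUP_upper2[of "const_bcontfun 1"]) auto
qed

lemma norm_le_of_op_norm_b_le:
  fixes A :: "'a::topological_space operator"
  assumes "op_norm_b A \<le> ereal c" "A 0 = 0"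
  shows "norm (A f) \<le> c * norm f"
proof (cases "f = 0")
  case False
  have "ereal (norm (A f) / norm f) \<le> op_norm_s A"
    unfolding op_norm_s_def using False by (intro SUP_upper2[of f]) auto
  also have "\<dots> \<le> ereal c"
    using assms by (simp add: op_norm_b_def flip: zero_ereal_def)
  finally show ?thesis
    using False by (simp add: field_simps)
qed (use assms in simp)

lemma bounded_operatorI:
  fixes A :: "'a::topological_space operator"
  assumes "\<And>f. norm (A f) \<le> c * norm f"
  shows "bounded_operator A"
  using op_norm_s_le[of A c] assms unfolding bounded_operator_def
  by (metis less_ereal.simps(4) order_le_less_trans ereal_infty_less(1))

text \<open>At \<open>f = 0\<close> the bound forces \<open>A n 0 = L 0\<close>, so only the
  \<open>op_norm_s\<close> part remains. Index 0 is excluded because \<open>c / 0 = 0\<close> would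
  demand equality there.\<close>

lemma op_tendstoI:
  fixes L :: "'a::topological_space operator"
  assumes "\<And>n. bounded_operator (A n)" "bounded_operator L"
    and bound: "\<And>n f. n > 0 \<Longrightarrow> norm (A n f - L f) \<le> c / real n * norm f"
  shows "op_tendsto A L"
  unfolding op_tendsto_def
proof (intro conjI allI)
  show "(\<lambda>n. op_norm_b (\<lambda>f. A n f - L f)) \<longlonglongrightarrow> 0"
  proof (rule tendsto_sandwich)
    show "eventually (\<lambda>n. 0 \<le> op_norm_b (\<lambda>f. A n f - L f)) sequentially"
      by (simp add: op_norm_b_def op_norm_s_nonneg)
    have "op_norm_b (\<lambda>f. A n f - L f) \<le> ereal (c / real n)" if "n > 0" for n
    proof -
      have "norm (A n 0 - L 0) = 0"
        using bound[OF that, of 0] by simp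
      then show ?thesis
        using op_norm_s_le[OF bound[OF that]] by (simp add: op_norm_b_def flip: zero_ereal_def)
    qed
    then show "eventually (\<lambda>n. op_norm_b (\<lambda>f. A n f - L f) \<le> ereal (c / real n)) sequentially"
      using eventually_gt_at_top[of 0] by (rule eventually_mono[rotated])
    show "(\<lambda>n. ereal (c / real n)) \<longlonglongrightarrow> 0"
      unfolding zero_ereal_def by (intro tendsto_ereal lim_const_over_n)
  qed simp
qed (use assms in auto)

text \<open>Subadditivity gives \<open>A u - A v \<le> A (u - v)\<close> pointwise; exchanging
  \<open>u\<close> and \<open>v\<close> bounds the absolute value.\<close>

lemma subadditive_lipschitz:
  fixes A :: "'a::topological_space operator"
  assumes sub: "\<And>f g x. apply_bcontfun (A (f + g)) x \<le> apply_bcontfun (A f) x + apply_bcontfun (A g) x"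
    and bound: "\<And>f. norm (A f) \<le> c * norm f"
  shows "norm (A f - A g) \<le> c * norm (f - g)"
proof (rule norm_bound)
  fix x
  have "apply_bcontfun (A u) x - apply_bcontfun (A v) x \<le> c * norm (u - v)" for u v
    using sub[of v "u - v" x] norm_bounded[of "A (u - v)" x] bound[of "u - v"] by simp
  from this[of f g] this[of g f] show "norm (apply_bcontfun (A f - A g) x) \<le> c * norm (f - g)"
    by (simp add: norm_minus_commute)
qed

section \<open>Sublinear transition operators and their increments\<close>

context
  fixes T :: "'a::topological_space operator"
  assumes T: "sublinear_transition_operator T"
begin

lemma transition_scaleR: "c \<ge> 0 \<Longrightarrow> T (c *\<^sub>R f) = c *\<^sub>R T f"
  using T by (simp add: sublinear_transition_operator_def)

lemma transition_subadd: "apply_bcontfun (T (f + g)) x \<le> apply_bcontfun (T f) x + apply_bcontfun (T g) x"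
  using T by (simp add: sublinear_transition_operator_def)

lemma transition_le_SUP: "apply_bcontfun (T f) x \<le> (SUP y. apply_bcontfun f y)"
  using T by (simp add: sublinear_transition_operator_def)

lemma transition_zero: "T 0 = 0"
  using transition_scaleR[of 0 0] by simp

lemma transition_lower: "- apply_bcontfun (T (- f)) x \<le> apply_bcontfun (T f) x"
  using transition_subadd[of f "- f" x] transition_zero by simp

lemma transition_norm_le: "norm (T f) \<le> norm f"
proof (rule norm_bound)
  fix x
  have "apply_bcontfun (T g) x \<le> norm g" for g
  proof -
    have "(SUP y. apply_bcontfun g y) \<le> norm g"
      using norm_bounded[of g] by (intro cSUP_least) (auto simp: abs_le_iff)
    then show ?thesis
      using transition_le_SUP[of g x] by linarith
  qed
  from this[of f] this[of "- f"] show "norm (apply_bcontfun (T f) x) \<le> norm f"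
    using transition_lower[of f x] by simp
qed

text \<open>The supremum bound at \<open>\<mu>\<close> gives one inequality; at
  \<open>- \<mu>\<close>, combined with \<open>transition_lower\<close>, it gives the other.\<close>

lemma transition_const: "T (const_bcontfun \<mu>) = const_bcontfun \<mu>"
proof (rule bcontfun_eqI)
  fix x
  have "- const_bcontfun \<mu> = (const_bcontfun (- \<mu>) :: 'a bfun)"
    by (rule bcontfun_eqI) simp
  then show "apply_bcontfun (T (const_bcontfun \<mu>)) x = apply_bcontfun (const_bcontfun \<mu>) x"
    using transition_le_SUP[of "const_bcontfun \<mu>" x] transition_le_SUP[of "const_bcontfun (- \<mu>)" x]
      transition_lower[of "const_bcontfun \<mu>" x]
    by simp
qed

lemma transition_nonexpansive: "norm (T f - T g) \<le> norm (f - g)"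
  using subadditive_lipschitz[of T 1] transition_subadd transition_norm_le by simp

text \<open>Subtracting the linear identity preserves subadditivity, so
  \<open>subadditive_lipschitz\<close> applies to \<open>T - I\<close>.\<close>

lemma transition_increment_lipschitz:
  assumes "\<And>h. norm (T h - h) \<le> e * norm h"
  shows "norm ((T f - f) - (T g - g)) \<le> e * norm (f - g)"
proof (rule subadditive_lipschitz[of "\<lambda>f. T f - f"])
  show "apply_bcontfun (T (f + g) - (f + g)) x
      \<le> apply_bcontfun (T f - f) x + apply_bcontfun (T g - g) x" for f g x
    using transition_subadd[of f g x] by simp
qed (use assms in auto)

text \<open>The sign condition holds because \<open>T f x\<close> is at most the supremum of
  \<open>f\<close>, which is \<open>f x\<close> at a maximiser.\<close>

lemma rate_of_transition:
  assumes "c \<ge> 0"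
  shows "sublinear_rate_operator (\<lambda>f. c *\<^sub>R (T f - f))"
  unfolding sublinear_rate_operator_def
proof (intro conjI allI impI)
  show "c *\<^sub>R (T (a *\<^sub>R f) - a *\<^sub>R f) = a *\<^sub>R c *\<^sub>R (T f - f)" if "a \<ge> 0" for a f
    using that by (simp add: transition_scaleR algebra_simps)
  show "apply_bcontfun (c *\<^sub>R (T (f + g) - (f + g))) x
      \<le> apply_bcontfun (c *\<^sub>R (T f - f)) x + apply_bcontfun (c *\<^sub>R (T g - g)) x" for f g x
    using mult_left_mono[OF transition_subadd[of f g x] assms] by (simp add: algebra_simps)
  show "c *\<^sub>R (T (const_bcontfun \<mu>) - const_bcontfun \<mu>) = 0" for \<mu>
    by (simp add: transition_const)
  show "apply_bcontfun (c *\<^sub>R (T f - f)) x \<le> 0"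
    if "(SUP y. apply_bcontfun f y) = apply_bcontfun f x \<and> apply_bcontfun f x \<ge> 0" for f x
    using transition_le_SUP[of f x] that assms by (simp add: mult_nonneg_nonpos)
qed

end

text \<open>The library has this only for \<open>'a :: metric_space\<close>.\<close>

lemma bfun_Cauchy_convergent:
  fixes F :: "nat \<Rightarrow> 'a::topological_space bfun"
  assumes "Cauchy F"
  shows "convergent F"
proof -
  obtain g where "uniform_limit UNIV F g sequentially"
    using uniformly_convergent_eq_cauchy[of "\<lambda>_. True" F] assms
    unfolding Cauchy_def uniform_limit_sequentially_iff
    by (metis dist_fun_lt_imp_dist_val_lt)
  then obtain l where "F \<longlonglongrightarrow> l"
    by (metis uniform_limit_bcontfunE sequentially_bot)
  then show ?thesis
    by (rule convergentI)
qed

lemma tendsto_apply_bcontfun: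
  fixes f :: "'a::topological_space bfun"
  assumes "F \<longlonglongrightarrow> f"
  shows "(\<lambda>n. apply_bcontfun (F n) x) \<longlonglongrightarrow> apply_bcontfun f x"
  using tendsto_bcontfun_uniform_limit[OF assms] by (rule tendsto_uniform_limitI) simp

text \<open>Every condition is an equality or weak inequality in the values of the operator, hence
  closed under pointwise limits; the premise on the supremum involves only \<open>f\<close>.\<close>

lemma sublinear_rate_operator_limit:
  fixes Q :: "'a::topological_space operator"
  assumes A: "\<And>n. sublinear_rate_operator (A n)" and lim: "\<And>f. (\<lambda>n. A n f) \<longlonglongrightarrow> Q f"
  shows "sublinear_rate_operator Q"
  unfolding sublinear_rate_operator_def
proof (intro conjI allI impI)
  note rate = A[unfolded sublinear_rate_operator_def]
  show "Q (c *\<^sub>R f) = c *\<^sub>R Q f" if "c \<ge> 0" for c f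
    using lim[of "c *\<^sub>R f"] tendsto_scaleR[OF tendsto_const lim[of f], of c] rate that
    by (auto intro: LIMSEQ_unique)
  show "apply_bcontfun (Q (f + g)) x \<le> apply_bcontfun (Q f) x + apply_bcontfun (Q g) x" for f g x
    using rate by (intro LIMSEQ_le[OF tendsto_apply_bcontfun[OF lim]
        tendsto_add[OF tendsto_apply_bcontfun[OF lim] tendsto_apply_bcontfun[OF lim]]]) auto
  show "Q (const_bcontfun \<mu>) = 0" for \<mu>
    using lim[of "const_bcontfun \<mu>"] rate by (auto intro: LIMSEQ_unique)
  show "apply_bcontfun (Q f) x \<le> 0"
    if "(SUP y. apply_bcontfun f y) = apply_bcontfun f x \<and> apply_bcontfun f x \<ge> 0" for f x
    using rate that by (intro LIMSEQ_le_const2[OF tendsto_apply_bcontfun[OF lim]]) auto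
qed

section \<open>Application to the space of bounded functions\<close>

theorem theorem23:
  fixes T :: "real \<Rightarrow> ('a::{countable, discrete_topology}) operator"
  assumes "operator_semigroup T"
    and "\<And>t. t \<ge> 0 \<Longrightarrow> sublinear_transition_operator (T t)"
    and "uniformly_continuous_family T"
  shows "op_convergent (log_approx T)
    \<and> bounded_operator (op_log T)
    \<and> sublinear_rate_operator (op_log T)
    \<and> (\<forall>t\<ge>0. T t = op_exp t (op_log T))"
proof -
  note trans = assms(2)
  have T0: "T 0 = id" and T_add: "\<And>s t. s \<ge> 0 \<Longrightarrow> t \<ge> 0 \<Longrightarrow> T (s + t) = T s \<circ> T t"
    using assms(1) by (auto simp: operator_semigroup_def)
  have "((\<lambda>s. op_norm_b (\<lambda>f. T s f - T 0 f)) \<longlongrightarrow> 0) (at 0 within {0..})"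
    using assms(3) by (auto simp: uniformly_continuous_family_def)
  then have "eventually (\<lambda>s. op_norm_b (\<lambda>f. T s f - f) < ereal (1/2)) (at 0 within {0..})"
    unfolding T0 id_apply by (rule order_tendstoD) simp
  then obtain d where d: "d > 0"
    "\<And>s. s \<ge> 0 \<Longrightarrow> s \<noteq> 0 \<Longrightarrow> s < d \<Longrightarrow> op_norm_b (\<lambda>f. T s f - f) < ereal (1/2)"
    by (auto simp: eventually_at dist_real_def)
  \<comment> \<open>The filter omits \<open>s = 0\<close>, which \<open>T0\<close> settles; halving
    \<open>d\<close> turns the strict bound \<open>s < d\<close> into a closed interval.\<close>
  have near_id: "norm (T s f - f) \<le> 1/2 * norm f" if "0 \<le> s" "s \<le> d / 2" for s f
  proof (cases "s = 0")
    case False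
    show ?thesis
      using norm_le_of_op_norm_b_le[OF less_imp_le[OF d(2)[of s]]] that False d(1)
        transition_zero[OF trans] by simp
  qed (simp add: T0)
  interpret lipschitz_semigroup T "d / 2"
  proof
    show "norm ((T s f - f) - (T s g - g)) \<le> e * norm (f - g)"
      if "s \<ge> 0" "\<And>h. norm (T s h - h) \<le> e * norm h" for s e f g
      using that by (intro transition_increment_lipschitz trans)
    show "norm (T s f - f) \<le> 1/2 * norm f" if "0 \<le> s" "s \<le> d / 2" for s f
      using that by (rule near_id)
  qed (simp_all add: bfun_Cauchy_convergent T0 T_add d(1) transition_zero[OF trans]
      transition_nonexpansive[OF trans])
  have quot: "log_approx T = quot"
    by (intro ext) (simp add: log_approx_def quot_def)
  have bounded: "bounded_operator generator"
    by (rule bounded_operatorI[OF generator_le])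
  have tendsto: "op_tendsto (log_approx T) generator"
    unfolding quot
    by (rule op_tendstoI[OF bounded_operatorI[OF quot_le] bounded quot_generator])
  then have log: "op_log T = generator"
    unfolding op_log_def by (rule op_lim_eqI)
  \<comment> \<open>This includes \<open>n = 0\<close>: there \<open>1 / real n\<close> is 0, still
    an admissible time.\<close>
  have "sublinear_rate_operator (quot n)" for n
    using rate_of_transition[OF trans, of "1 / real n" "real n"] by (simp add: quot_def[abs_def])
  then have "sublinear_rate_operator generator"
    by (rule sublinear_rate_operator_limit[OF _ quot_tendsto])
  moreover have "op_exp t generator = T t" if t: "t \<ge> 0" for t
    unfolding op_exp_def
  proof (rule op_lim_eqI, rule op_tendstoI)
    show "bounded_operator ((\<lambda>f. f + (t / real n) *\<^sub>R generator f) ^^ n)" for n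
      by (rule bounded_operatorI[OF euler_step_le]) (use t in simp)
    show "bounded_operator (T t)"
      using transition_norm_le[OF trans[OF t]] by (intro bounded_operatorI[where c = 1]) simp
  qed (rule euler_scheme_error[OF t])
  ultimately show ?thesis
    using tendsto bounded by (auto simp: log op_convergent_def)
qed

end
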